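(* Let $n\ge 2$ and $1\le k<n$. Let $G$ be the graph with vertex set $V=\{x\in\{0,1\}^n:\sum_i x_i=k\}$, where $x\sim y$ iff $|\mathrm{supp}(x-y)|=2$. Then $\mathrm{Ric}(G)=1+\frac n2$.
   Context: For a graph $G=(V,E)$ (undirected, simple, locally finite, no isolated vertices; $y\sim x$ means adjacency) and $f,g:V\to\mathbb R$ define $\Delta f(x)=\sum_{y\sim x}(f(y)-f(x))$, $\Gamma(f,g)(x)=\frac12\sum_{y\sim x}(f(x)-f(y))(g(x)-g(y))$, $\Gamma(f)=\Gamma(f,f)$, $\Gamma_2(f)=\frac12\Delta\Gamma(f)-\Gamma(f,\Delta f)$. The curvature $\mathrm{Ric}(G)$ is the largest $K\in\mathbb R$ such that $\Gamma_2(f)(x)\ge K\,\Gamma(f)(x)$ for all $f:V\to\mathbb R$ and all $x\in V$. *)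

theory Defs
  imports Complex_Main "HOL-Library.FuncSet"
begin

text \<open>
  A graph is a vertex set \<open>V\<close> with an adjacency predicate \<open>E\<close>, of which only the restriction
  to \<open>V\<close> matters. All sums run over neighbours in \<open>V\<close>, so for \<open>x \<in> V\<close> the operators
  below depend only on the restriction to \<open>V\<close> of a function \<open>f :: 'a \<Rightarrow> real\<close>; this is how
  functions on \<open>V\<close> are represented.
\<close>

definition nbrs :: "'a set \<Rightarrow> ('a \<Rightarrow> 'a \<Rightarrow> bool) \<Rightarrow> 'a \<Rightarrow> 'a set" where
  "nbrs V E x = {y \<in> V. E x y}"

locale locally_finite_graph =
  fixes V :: "'a set" and E :: "'a \<Rightarrow> 'a \<Rightarrow> bool"
  assumes sym: "\<And>x y. x \<in> V \<Longrightarrow> y \<in> V \<Longrightarrow> E x y \<Longrightarrow> E y x"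
    and irrefl: "\<And>x. x \<in> V \<Longrightarrow> \<not> E x x"
    and finite_nbrs: "\<And>x. x \<in> V \<Longrightarrow> finite (nbrs V E x)"
    and not_isolated: "\<And>x. x \<in> V \<Longrightarrow> nbrs V E x \<noteq> {}"

definition Laplacian ::
  "'a set \<Rightarrow> ('a \<Rightarrow> 'a \<Rightarrow> bool) \<Rightarrow> ('a \<Rightarrow> real) \<Rightarrow> 'a \<Rightarrow> real" where
  "Laplacian V E f x = (\<Sum>y\<in>nbrs V E x. f y - f x)"

definition Gamma ::
  "'a set \<Rightarrow> ('a \<Rightarrow> 'a \<Rightarrow> bool) \<Rightarrow> ('a \<Rightarrow> real) \<Rightarrow> ('a \<Rightarrow> real) \<Rightarrow> 'a \<Rightarrow> real" where
  "Gamma V E f g x = 1/2 * (\<Sum>y\<in>nbrs V E x. (f x - f y) * (g x - g y))"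

definition Gamma2 ::
  "'a set \<Rightarrow> ('a \<Rightarrow> 'a \<Rightarrow> bool) \<Rightarrow> ('a \<Rightarrow> real) \<Rightarrow> 'a \<Rightarrow> real" where
  "Gamma2 V E f x =
     1/2 * Laplacian V E (Gamma V E f f) x - Gamma V E f (Laplacian V E f) x"

definition curvature_ge :: "'a set \<Rightarrow> ('a \<Rightarrow> 'a \<Rightarrow> bool) \<Rightarrow> real \<Rightarrow> bool" where
  "curvature_ge V E K \<longleftrightarrow> (\<forall>f. \<forall>x\<in>V. Gamma2 V E f x \<ge> K * Gamma V E f f x)"

definition is_Ric :: "'a set \<Rightarrow> ('a \<Rightarrow> 'a \<Rightarrow> bool) \<Rightarrow> real \<Rightarrow> bool" where
  "is_Ric V E K \<longleftrightarrow> curvature_ge V E K \<and> (\<forall>K'. curvature_ge V E K' \<longrightarrow> K' \<le> K)"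

text \<open>Meaningful only if a largest curvature bound exists, i.e. if some \<open>K\<close> satisfies \<open>is_Ric V E K\<close>.\<close>

definition Ric :: "'a set \<Rightarrow> ('a \<Rightarrow> 'a \<Rightarrow> bool) \<Rightarrow> real" where
  "Ric V E = (THE K. is_Ric V E K)"

text \<open>
  Points of \<open>{0,1}^n\<close> are integer-valued functions on \<open>{1..n}\<close>, extensional (so that equality
  of points is equality of coordinates).
\<close>

definition slice_verts :: "nat \<Rightarrow> nat \<Rightarrow> (nat \<Rightarrow> int) set" where
  "slice_verts n k = {x \<in> {1..n} \<rightarrow>\<^sub>E {0, 1}. (\<Sum>i=1..n. x i) = int k}"

definition slice_adj :: "nat \<Rightarrow> (nat \<Rightarrow> int) \<Rightarrow> (nat \<Rightarrow> int) \<Rightarrow> bool" where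
  "slice_adj n x y \<longleftrightarrow> card {i \<in> {1..n}. x i - y i \<noteq> 0} = 2"

lemma finite_slice_verts: "finite (slice_verts n k)"
  unfolding slice_verts_def
  by (rule finite_subset[of _ "{1..n} \<rightarrow>\<^sub>E {0, 1}"]) (auto intro!: finite_PiE)

lemma is_Ric_imp_Ric: "is_Ric V E K \<Longrightarrow> Ric V E = K"
  unfolding Ric_def is_Ric_def by (intro the_equality) (auto intro: antisym)

lemma slice_graph:
  assumes "1 \<le> k" "k < n"
  shows "locally_finite_graph (slice_verts n k) (slice_adj n)"
proof
  fix x y :: "nat \<Rightarrow> int" assume "slice_adj n x y"
  moreover have "{i \<in> {1..n}. x i - y i \<noteq> 0} = {i \<in> {1..n}. y i - x i \<noteq> 0}" by auto
  ultimately show "slice_adj n y x" unfolding slice_adj_def by simp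
next
  fix x show "\<not> slice_adj n x x" by (simp add: slice_adj_def)
next
  fix x show "finite (nbrs (slice_verts n k) (slice_adj n) x)"
    by (simp add: nbrs_def finite_slice_verts)
next
  fix x assume x: "x \<in> slice_verts n k"
  have xE: "x \<in> {1..n} \<rightarrow>\<^sub>E {0, 1}" and xs: "(\<Sum>i=1..n. x i) = int k"
    using x by (auto simp: slice_verts_def)
  have "\<exists>i\<in>{1..n}. x i \<noteq> 0"
  proof (rule ccontr)
    assume "\<not> ?thesis"
    then have "(\<Sum>i=1..n. x i) = 0" by (intro sum.neutral) auto
    with xs assms show False by simp
  qed
  then obtain i where i: "i \<in> {1..n}" "x i = 1" using xE by (auto dest: PiE_mem)
  have "\<exists>j\<in>{1..n}. x j \<noteq> 1"
  proof (rule ccontr)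
    assume "\<not> ?thesis"
    then have "(\<Sum>i=1..n. x i) = (\<Sum>i=1..n. 1)" by (intro sum.cong) auto
    with xs assms show False by simp
  qed
  then obtain j where j: "j \<in> {1..n}" "x j = 0" using xE by (auto dest: PiE_mem)
  define y where "y = x(i := 0, j := 1)"
  have ij: "i \<noteq> j" using i j by auto
  have "(\<Sum>l=1..n. y l) = (\<Sum>l=1..n. x l + (if l = j then 1 else 0) - (if l = i then 1 else 0))"
    using i j ij by (intro sum.cong) (auto simp: y_def)
  also have "\<dots> = int k" using xs i j by (simp add: sum.distrib sum_subtractf)
  finally have "y \<in> slice_verts n k"
    using xE i j by (auto simp: slice_verts_def y_def PiE_def Pi_def extensional_def)
  moreover have "{l \<in> {1..n}. x l - y l \<noteq> 0} = {i, j}" using i j ij by (auto simp: y_def)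
  then have "slice_adj n x y" using ij by (simp add: slice_adj_def)
  ultimately show "nbrs (slice_verts n k) (slice_adj n) x \<noteq> {}" by (auto simp: nbrs_def)
qed

end

theory Submission
  imports Defs
begin

text \<open>
  Put \<open>m = n - k\<close>. The neighbours of \<open>x\<close> are the cells of a \<open>k \<times> m\<close> matrix (exchange a one
  for a zero), neighbours being adjacent to each other iff they share a row or a column, and the
  vertices at distance two are the \<open>2 \<times> 2\<close> submatrices, each adjacent to its four cells. Let \<open>M\<close>
  be the matrix of the values of \<open>f - f x\<close>. Minimising \<open>\<Gamma>\<^sub>2\<close> over the values at distance two gives
  \<open>4 \<Gamma>\<^sub>2 - (n + 2) \<Sum>M\<^sup>2 \<ge> (k m + 2 k + 2 m) \<Sum>M\<^sup>2 - (k + 2) P - (m + 2) C + (\<Sum>M)\<^sup>2\<close>,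
  where \<open>P\<close> and \<open>C\<close> are the sums of the squared row and column sums. The right-hand side is
  nonnegative: \<open>k m \<Sum>M\<^sup>2 - k P - m C + (\<Sum>M)\<^sup>2\<close> is a sum of squares of mixed differences
  \<open>M a c - M i c - M a j + M i j\<close>, and \<open>P \<le> m \<Sum>M\<^sup>2\<close>, \<open>C \<le> k \<Sum>M\<^sup>2\<close> by Cauchy-Schwarz.
  Equality holds for the distance from \<open>x\<close>.
\<close>

section \<open>The form \<open>Gamma2\<close> at a vertex with the same degree as its
  neighbours\<close>

text \<open>All operators ignore additive constants, so \<open>f\<close> may be replaced by
  \<open>g\<close>, which vanishes at \<open>x\<close>. Equal degrees turn the cross term of
  \<open>Gamma V E f (Laplacian V E f)\<close> into a completed square: \<open>(g z - g y)^2 - 2 * g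
  y * (g z - g y) + (g y)^2 = (g z - 2 * g y)^2\<close>. Values at distance two then enter only
  through these squares, so they can be minimised out explicitly.\<close>

lemma Gamma2_regular:
  fixes f :: "'a \<Rightarrow> real"
  assumes fin: "finite (nbrs V E x)"
    and deg: "card (nbrs V E x) = d" "\<And>y. y \<in> nbrs V E x \<Longrightarrow> card (nbrs V E y) = d"
  defines "g \<equiv> \<lambda>y. f y - f x"
  shows "4 * Gamma2 V E f x =
      (\<Sum>y\<in>nbrs V E x. \<Sum>z\<in>nbrs V E y. (g z - 2 * g y)\<^sup>2)
      - 2 * real d * (\<Sum>y\<in>nbrs V E x. (g y)\<^sup>2) + 2 * (\<Sum>y\<in>nbrs V E x. g y)\<^sup>2"
proof -
  let ?N = "nbrs V E"
  have L: "Laplacian V E f y = (\<Sum>z\<in>?N y. g z - g y)" for y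
    by (simp add: Laplacian_def g_def)
  have Lx: "Laplacian V E f x = (\<Sum>y\<in>?N x. g y)"
    by (simp add: Laplacian_def g_def)
  have G: "Gamma V E f f y = 1/2 * (\<Sum>z\<in>?N y. (g z - g y)\<^sup>2)" for y
    by (simp add: Gamma_def g_def power2_eq_square algebra_simps)
  have Gx: "Gamma V E f f x = 1/2 * (\<Sum>y\<in>?N x. (g y)\<^sup>2)"
    by (simp add: G) (simp add: g_def)
  have LG: "Laplacian V E (Gamma V E f f) x =
      (\<Sum>y\<in>?N x. 1/2 * (\<Sum>z\<in>?N y. (g z - g y)\<^sup>2)) - real d / 2 * (\<Sum>y\<in>?N x. (g y)\<^sup>2)"
    unfolding Laplacian_def sum_subtractf by (simp add: deg Gx) (simp add: G)
  have GL: "Gamma V E f (Laplacian V E f) x =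
      1/2 * (\<Sum>y\<in>?N x. g y * (\<Sum>z\<in>?N y. g z - g y)) - 1/2 * (\<Sum>y\<in>?N x. g y)\<^sup>2"
  proof -
    have "Gamma V E f (Laplacian V E f) x =
        1/2 * (\<Sum>y\<in>?N x. g y * Laplacian V E f y - g y * Laplacian V E f x)"
      unfolding Gamma_def by (simp add: g_def algebra_simps)
    also have "\<dots> = 1/2 * ((\<Sum>y\<in>?N x. g y * Laplacian V E f y)
        - (\<Sum>y\<in>?N x. g y) * Laplacian V E f x)"
      by (simp add: sum_subtractf sum_distrib_right)
    finally show ?thesis
      unfolding Lx unfolding L by (simp add: power2_eq_square right_diff_distrib)
  qed
  have pt: "(\<Sum>z\<in>?N y. (g z - 2 * g y)\<^sup>2) =
      (\<Sum>z\<in>?N y. (g z - g y)\<^sup>2) - 2 * (g y * (\<Sum>z\<in>?N y. g z - g y)) + real d * (g y)\<^sup>2"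
    if "y \<in> ?N x" for y
  proof -
    have "(\<Sum>z\<in>?N y. (g z - 2 * g y)\<^sup>2) =
        (\<Sum>z\<in>?N y. (g z - g y)\<^sup>2 - 2 * (g y * (g z - g y)) + (g y)\<^sup>2)"
      by (intro sum.cong refl) (simp add: power2_eq_square algebra_simps)
    also have "\<dots> = (\<Sum>z\<in>?N y. (g z - g y)\<^sup>2) - 2 * (g y * (\<Sum>z\<in>?N y. g z - g y))
        + real d * (g y)\<^sup>2"
      using deg(2)[OF that]
      by (simp only: sum.distrib sum_subtractf[where g="\<lambda>z. 2 * (g y * (g z - g y))"]
          sum_distrib_left sum_constant)
    finally show ?thesis .
  qed
  have "(\<Sum>y\<in>?N x. \<Sum>z\<in>?N y. (g z - 2 * g y)\<^sup>2) =
      (\<Sum>y\<in>?N x. \<Sum>z\<in>?N y. (g z - g y)\<^sup>2)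
      - 2 * (\<Sum>y\<in>?N x. g y * (\<Sum>z\<in>?N y. g z - g y)) + real d * (\<Sum>y\<in>?N x. (g y)\<^sup>2)"
    by (simp only: pt sum.distrib sum_subtractf[where f="\<lambda>y. \<Sum>z\<in>?N y. (g z - g y)\<^sup>2"]
        sum_distrib_left cong: sum.cong)
  then show ?thesis
    unfolding Gamma2_def LG GL sum_distrib_left[symmetric] by (simp add: field_simps)
qed

section \<open>Quadratic inequalities for matrices\<close>

text \<open>The mixed terms of the expanded square factor as the square of the sum. With
  \<open>p\<close> and \<open>q\<close> free, one identity serves the pairwise differences
  (\<open>1\<close>, \<open>-1\<close>), the squares from adjacent neighbours (\<open>-2\<close>,
  \<open>1\<close>) and the signed rectangles (\<open>1\<close>, \<open>p\<close>).\<close>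

lemma sum_sum_square:
  fixes u :: "'a \<Rightarrow> real"
  shows "(\<Sum>i\<in>A. \<Sum>j\<in>A. (p * u i + q * u j)\<^sup>2) =
    (p\<^sup>2 + q\<^sup>2) * real (card A) * (\<Sum>i\<in>A. (u i)\<^sup>2) + 2 * p * q * (\<Sum>i\<in>A. u i)\<^sup>2"
proof -
  have "(\<Sum>i\<in>A. \<Sum>j\<in>A. (p * u i + q * u j)\<^sup>2) =
      (\<Sum>i\<in>A. \<Sum>j\<in>A. p\<^sup>2 * (u i)\<^sup>2 + q\<^sup>2 * (u j)\<^sup>2 + 2 * p * q * (u i * u j))"
    by (intro sum.cong refl) (simp add: power2_eq_square algebra_simps)
  also have "\<dots> = real (card A) * (p\<^sup>2 * (\<Sum>i\<in>A. (u i)\<^sup>2)) + real (card A) * (q\<^sup>2 * (\<Sum>i\<in>A. (u i)\<^sup>2))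
      + 2 * p * q * (\<Sum>i\<in>A. \<Sum>j\<in>A. u i * u j)"
    by (simp add: sum.distrib sum_distrib_left)
  also have "(\<Sum>i\<in>A. \<Sum>j\<in>A. u i * u j) = (\<Sum>i\<in>A. u i)\<^sup>2"
    by (simp add: power2_eq_square sum_product)
  finally show ?thesis by (simp add: algebra_simps)
qed

lemma sum_sum_sum_square_rows:
  fixes M :: "'a \<Rightarrow> 'b \<Rightarrow> real"
  shows "(\<Sum>a\<in>A. \<Sum>c\<in>B. \<Sum>j\<in>B. (p * M a c + q * M a j)\<^sup>2) =
    (p\<^sup>2 + q\<^sup>2) * real (card B) * (\<Sum>a\<in>A. \<Sum>c\<in>B. (M a c)\<^sup>2)
    + 2 * p * q * (\<Sum>a\<in>A. (\<Sum>c\<in>B. M a c)\<^sup>2)"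
  by (simp only: sum_sum_square sum.distrib sum_distrib_left)

lemma sum_sum_sum_square_cols:
  fixes M :: "'a \<Rightarrow> 'b \<Rightarrow> real"
  shows "(\<Sum>a\<in>A. \<Sum>c\<in>B. \<Sum>i\<in>A. (p * M a c + q * M i c)\<^sup>2) =
    (p\<^sup>2 + q\<^sup>2) * real (card A) * (\<Sum>a\<in>A. \<Sum>c\<in>B. (M a c)\<^sup>2)
    + 2 * p * q * (\<Sum>c\<in>B. (\<Sum>a\<in>A. M a c)\<^sup>2)"
  using sum_sum_sum_square_rows[of p "\<lambda>c a. M a c" q A B]
  by (simp add: sum.swap[of _ A B])

text \<open>Two applications of \<open>sum_sum_square\<close>, first to the pair \<open>c\<close>,
  \<open>j\<close> and then to the pair \<open>a\<close>, \<open>i\<close>. The sign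
  \<open>p = 1\<close> is needed for the cost of minimising over \<open>W\<close>, and
  \<open>p = -1\<close> for the mixed differences that show nonnegativity.\<close>

lemma sum_rectangle_square:
  fixes M :: "'a \<Rightarrow> 'b \<Rightarrow> real"
  assumes p: "p\<^sup>2 = 1"
  shows "(\<Sum>a\<in>A. \<Sum>i\<in>A. \<Sum>c\<in>B. \<Sum>j\<in>B. (M a c + p * M i c + p * (M a j + p * M i j))\<^sup>2) =
    4 * real (card A) * real (card B) * (\<Sum>a\<in>A. \<Sum>c\<in>B. (M a c)\<^sup>2)
    + 4 * p * real (card A) * (\<Sum>a\<in>A. (\<Sum>c\<in>B. M a c)\<^sup>2)
    + 4 * p * real (card B) * (\<Sum>c\<in>B. (\<Sum>a\<in>A. M a c)\<^sup>2)
    + 4 * (\<Sum>a\<in>A. \<Sum>c\<in>B. M a c)\<^sup>2"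
proof -
  have "(\<Sum>c\<in>B. \<Sum>j\<in>B. (M a c + p * M i c + p * (M a j + p * M i j))\<^sup>2) =
      2 * real (card B) * (\<Sum>c\<in>B. (M a c + p * M i c)\<^sup>2)
      + 2 * p * ((\<Sum>c\<in>B. M a c) + p * (\<Sum>c\<in>B. M i c))\<^sup>2" for a i
    using sum_sum_square[where u="\<lambda>c. M a c + p * M i c" and p=1 and q=p and A=B]
    by (simp add: p sum.distrib sum_distrib_left)
  then have "(\<Sum>a\<in>A. \<Sum>i\<in>A. \<Sum>c\<in>B. \<Sum>j\<in>B. (M a c + p * M i c + p * (M a j + p * M i j))\<^sup>2) =
      2 * real (card B) * (\<Sum>a\<in>A. \<Sum>i\<in>A. \<Sum>c\<in>B. (M a c + p * M i c)\<^sup>2)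
      + 2 * p * (\<Sum>a\<in>A. \<Sum>i\<in>A. ((\<Sum>c\<in>B. M a c) + p * (\<Sum>c\<in>B. M i c))\<^sup>2)"
    by (simp add: sum.distrib sum_distrib_left)
  also have "(\<Sum>a\<in>A. \<Sum>i\<in>A. \<Sum>c\<in>B. (M a c + p * M i c)\<^sup>2) =
      2 * real (card A) * (\<Sum>a\<in>A. \<Sum>c\<in>B. (M a c)\<^sup>2) + 2 * p * (\<Sum>c\<in>B. (\<Sum>a\<in>A. M a c)\<^sup>2)"
    using sum_sum_sum_square_cols[of 1 M p A B] by (simp add: p sum.swap[of _ A B])
  also have "(\<Sum>a\<in>A. \<Sum>i\<in>A. ((\<Sum>c\<in>B. M a c) + p * (\<Sum>c\<in>B. M i c))\<^sup>2) =
      2 * real (card A) * (\<Sum>a\<in>A. (\<Sum>c\<in>B. M a c)\<^sup>2) + 2 * p * (\<Sum>a\<in>A. \<Sum>c\<in>B. M a c)\<^sup>2"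
    using sum_sum_square[where u="\<lambda>a. \<Sum>c\<in>B. M a c" and p=1 and q=p and A=A] by (simp add: p)
  moreover have "p * p = 1" using p by (simp add: power2_eq_square)
  ultimately show ?thesis by algebra
qed

text \<open>
  The four cells of a rectangle share the value \<open>W\<close>, and
  \<open>\<Sum>(W - 2 v)\<^sup>2\<close> over these cells is least at \<open>W = \<Sum>v / 2\<close>. The last two
  sums subtract the contribution of the degenerate rectangles \<open>a = i\<close> and \<open>c = j\<close>.
\<close>

lemma rectangle_sum_ge:
  fixes M :: "'a \<Rightarrow> 'b \<Rightarrow> real" and W :: "'a \<Rightarrow> 'a \<Rightarrow> 'b \<Rightarrow> 'b \<Rightarrow> real"
  assumes fin: "finite A" "finite B"
    and W1: "\<And>a i c j. W a i c j = W i a c j"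
    and W2: "\<And>a i c j. W a i c j = W a i j c"
  shows "4 * (\<Sum>a\<in>A. \<Sum>c\<in>B. \<Sum>i\<in>A-{a}. \<Sum>j\<in>B-{c}. (W a i c j - 2 * M a c)\<^sup>2)
    \<ge> 16 * real (card A) * real (card B) * (\<Sum>a\<in>A. \<Sum>c\<in>B. (M a c)\<^sup>2)
      - (\<Sum>a\<in>A. \<Sum>i\<in>A. \<Sum>c\<in>B. \<Sum>j\<in>B. (M a c + M i c + M a j + M i j)\<^sup>2)
      - 4 * (\<Sum>a\<in>A. \<Sum>c\<in>B. \<Sum>j\<in>B. (M a c - M a j)\<^sup>2)
      - 4 * (\<Sum>a\<in>A. \<Sum>c\<in>B. \<Sum>i\<in>A. (M a c - M i c)\<^sup>2)"
proof -
  \<comment> \<open>Extending by zero to degenerate rectangles lets \<open>S\<close> range over a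
    full product, where exchanging \<open>a\<close> with \<open>i\<close> or \<open>c\<close> with
    \<open>j\<close> is a symmetry.\<close>
  define T where "T a i c j = (if a \<noteq> i \<and> c \<noteq> j then (W a i c j - 2 * M a c)\<^sup>2 else 0)" for a i c j
  define S where "S F = (\<Sum>a\<in>A. \<Sum>i\<in>A. \<Sum>c\<in>B. \<Sum>j\<in>B. F a i c j)"
    for F :: "'a \<Rightarrow> 'a \<Rightarrow> 'b \<Rightarrow> 'b \<Rightarrow> real"
  have S_add: "S (\<lambda>a i c j. F a i c j + G a i c j) = S F + S G" for F G
    by (simp add: S_def sum.distrib)
  have S_diff: "S (\<lambda>a i c j. F a i c j - G a i c j) = S F - S G" for F G
    by (simp add: S_def sum_subtractf)
  have S_mult: "S (\<lambda>a i c j. r * F a i c j) = r * S F" for F r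
    by (simp add: S_def sum_distrib_left)
  have S_mono: "S F \<le> S G" if "\<And>a i c j. F a i c j \<le> G a i c j" for F G
    unfolding S_def by (intro sum_mono that)
  have S_row: "S (\<lambda>a i c j. F i a c j) = S F" for F
    unfolding S_def by (rule sum.swap)
  have S_col: "S (\<lambda>a i c j. F a i j c) = S F" for F
    unfolding S_def by (simp only: sum.swap[of "\<lambda>c j. F _ _ j c"])
  have ite: "(\<Sum>i\<in>X-{a}. u i) = (\<Sum>i\<in>X. if a \<noteq> i then u i else 0)"
    if "finite X" for X :: "'c set" and a and u :: "'c \<Rightarrow> real"
    using that by (intro sum.mono_neutral_cong_left) auto
  have "(\<Sum>i\<in>A-{a}. \<Sum>j\<in>B-{c}. (W a i c j - 2 * M a c)\<^sup>2) = (\<Sum>i\<in>A. \<Sum>j\<in>B. T a i c j)" for a c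
    unfolding ite[OF fin(1)] ite[OF fin(2)] by (rule sum.cong) (simp_all add: T_def)
  then have "(\<Sum>a\<in>A. \<Sum>c\<in>B. \<Sum>i\<in>A-{a}. \<Sum>j\<in>B-{c}. (W a i c j - 2 * M a c)\<^sup>2) =
      (\<Sum>a\<in>A. \<Sum>c\<in>B. \<Sum>i\<in>A. \<Sum>j\<in>B. T a i c j)"
    by simp
  also have "\<dots> = S T"
    unfolding S_def by (rule sum.cong[OF refl], rule sum.swap)
  finally have ST: "(\<Sum>a\<in>A. \<Sum>c\<in>B. \<Sum>i\<in>A-{a}. \<Sum>j\<in>B-{c}. (W a i c j - 2 * M a c)\<^sup>2) = S T" .
  \<comment> \<open>For a proper rectangle with cell values \<open>v\<close>, the two sides differ
    by \<open>(2 * W a i c j - \<Sum>v)^2\<close>. On a degenerate one the first two terms collapse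
    to four times the squared difference of its two values, which the \<open>if\<close> terms
    cancel, and \<open>T\<close> is zero.\<close>
  have key: "4 * ((M a c)\<^sup>2 + (M i c)\<^sup>2 + ((M a j)\<^sup>2 + (M i j)\<^sup>2)) - (M a c + M i c + M a j + M i j)\<^sup>2
      - 4 * (if a = i then (M a c - M a j)\<^sup>2 else 0) - 4 * (if c = j then (M a c - M i c)\<^sup>2 else 0)
      \<le> T a i c j + T i a c j + (T a i j c + T i a j c)" for a i c j
  proof (cases "a = i \<or> c = j")
    case True
    then show ?thesis
      by (auto simp: T_def power2_eq_square algebra_simps)
  next
    case False
    then have ne: "a \<noteq> i" "i \<noteq> a" "c \<noteq> j" "j \<noteq> c" by auto
    have "W i a c j = W a i c j" "W a i j c = W a i c j" "W i a j c = W a i c j"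
      using W1 W2 by metis+
    moreover have "0 \<le> (2 * W a i c j - (M a c + M i c + M a j + M i j))\<^sup>2" by simp
    ultimately show ?thesis
      using ne by (simp add: T_def power2_eq_square algebra_simps)
  qed
  have "S (\<lambda>a i c j. 4 * ((M a c)\<^sup>2 + (M i c)\<^sup>2 + ((M a j)\<^sup>2 + (M i j)\<^sup>2))
        - (M a c + M i c + M a j + M i j)\<^sup>2
        - 4 * (if a = i then (M a c - M a j)\<^sup>2 else 0) - 4 * (if c = j then (M a c - M i c)\<^sup>2 else 0))
      \<le> S (\<lambda>a i c j. T a i c j + T i a c j + (T a i j c + T i a j c))"
    by (intro S_mono key)
  \<comment> \<open>The four summands are relabellings of \<open>T\<close> under the two
    exchanges.\<close>
  also have "\<dots> = 4 * S T"
    using S_row[of T] S_col[of T] S_col[of "\<lambda>a i c j. T i a c j"] by (simp add: S_add)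
  finally have le: "4 * (S (\<lambda>a i c j. (M a c)\<^sup>2) + S (\<lambda>a i c j. (M i c)\<^sup>2)
        + (S (\<lambda>a i c j. (M a j)\<^sup>2) + S (\<lambda>a i c j. (M i j)\<^sup>2)))
        - S (\<lambda>a i c j. (M a c + M i c + M a j + M i j)\<^sup>2)
        - 4 * S (\<lambda>a i c j. if a = i then (M a c - M a j)\<^sup>2 else 0)
        - 4 * S (\<lambda>a i c j. if c = j then (M a c - M i c)\<^sup>2 else 0) \<le> 4 * S T"
    unfolding S_diff S_mult S_add .
  have s1: "S (\<lambda>a i c j. (M a c)\<^sup>2) = real (card A) * real (card B) * (\<Sum>a\<in>A. \<Sum>c\<in>B. (M a c)\<^sup>2)"
    by (simp add: S_def sum_distrib_left mult.assoc)
  have s2: "S (\<lambda>a i c j. (M i c)\<^sup>2) = S (\<lambda>a i c j. (M a c)\<^sup>2)"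
    by (rule S_row[of "\<lambda>a i c j. (M a c)\<^sup>2"])
  have s3: "S (\<lambda>a i c j. (M a j)\<^sup>2) = S (\<lambda>a i c j. (M a c)\<^sup>2)"
    by (rule S_col[of "\<lambda>a i c j. (M a c)\<^sup>2"])
  have s4: "S (\<lambda>a i c j. (M i j)\<^sup>2) = S (\<lambda>a i c j. (M i c)\<^sup>2)"
    by (rule S_col[of "\<lambda>a i c j. (M i c)\<^sup>2"])
  have d1: "S (\<lambda>a i c j. if a = i then (M a c - M a j)\<^sup>2 else 0) =
      (\<Sum>a\<in>A. \<Sum>c\<in>B. \<Sum>j\<in>B. (M a c - M a j)\<^sup>2)"
  proof -
    have "(\<Sum>i\<in>A. \<Sum>c\<in>B. \<Sum>j\<in>B. if a = i then (M a c - M a j)\<^sup>2 else 0) =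
        (\<Sum>i\<in>A. if a = i then (\<Sum>c\<in>B. \<Sum>j\<in>B. (M a c - M a j)\<^sup>2) else 0)" for a
      by (intro sum.cong) auto
    then show ?thesis by (simp add: S_def fin)
  qed
  have d2: "S (\<lambda>a i c j. if c = j then (M a c - M i c)\<^sup>2 else 0) =
      (\<Sum>a\<in>A. \<Sum>c\<in>B. \<Sum>i\<in>A. (M a c - M i c)\<^sup>2)"
    by (simp add: S_def fin sum.swap[of _ A B])
  show ?thesis
    using le unfolding ST s4 s3 s2 s1 d1 d2 by (simp add: S_def)
qed

text \<open>This is the curvature bound with the graph removed: \<open>M\<close> holds the values at
  the neighbours, \<open>W\<close> those at distance two. Once \<open>rectangle_sum_ge\<close> has
  eliminated \<open>W\<close>, only the four quantities \<open>s\<close>, \<open>P\<close>,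
  \<open>C\<close> and \<open>t\<close> remain.\<close>

lemma matrix_curvature_ge:
  fixes M :: "'a \<Rightarrow> 'b \<Rightarrow> real" and W :: "'a \<Rightarrow> 'a \<Rightarrow> 'b \<Rightarrow> 'b \<Rightarrow> real"
  assumes fin: "finite A" "finite B"
    and W1: "\<And>a i c j. W a i c j = W i a c j"
    and W2: "\<And>a i c j. W a i c j = W a i j c"
  defines "s \<equiv> \<Sum>a\<in>A. \<Sum>c\<in>B. (M a c)\<^sup>2"
  shows "(real (card A) + real (card B) + 2) * s \<le>
    (\<Sum>a\<in>A. \<Sum>c\<in>B. 4 * (M a c)\<^sup>2 + (\<Sum>j\<in>B-{c}. (M a j - 2 * M a c)\<^sup>2)
       + (\<Sum>i\<in>A-{a}. (M i c - 2 * M a c)\<^sup>2)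
       + (\<Sum>i\<in>A-{a}. \<Sum>j\<in>B-{c}. (W a i c j - 2 * M a c)\<^sup>2))
    - 2 * (real (card A) * real (card B)) * s + 2 * (\<Sum>a\<in>A. \<Sum>c\<in>B. M a c)\<^sup>2"
proof -
  define P where "P = (\<Sum>a\<in>A. (\<Sum>c\<in>B. M a c)\<^sup>2)"
  define C where "C = (\<Sum>c\<in>B. (\<Sum>a\<in>A. M a c)\<^sup>2)"
  define t where "t = (\<Sum>a\<in>A. \<Sum>c\<in>B. M a c)\<^sup>2"
  define w where "w = (\<Sum>a\<in>A. \<Sum>c\<in>B. \<Sum>i\<in>A-{a}. \<Sum>j\<in>B-{c}. (W a i c j - 2 * M a c)\<^sup>2)"
  let ?k = "real (card A)" and ?m = "real (card B)"
  have rows: "(\<Sum>a\<in>A. \<Sum>c\<in>B. \<Sum>j\<in>B. (p * M a c + q * M a j)\<^sup>2) =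
      (p\<^sup>2 + q\<^sup>2) * ?m * s + 2 * p * q * P" for p q
    unfolding s_def P_def by (rule sum_sum_sum_square_rows)
  have cols: "(\<Sum>a\<in>A. \<Sum>c\<in>B. \<Sum>i\<in>A. (p * M a c + q * M i c)\<^sup>2) =
      (p\<^sup>2 + q\<^sup>2) * ?k * s + 2 * p * q * C" for p q
    unfolding s_def C_def by (rule sum_sum_sum_square_cols)
  have rows1: "(\<Sum>a\<in>A. \<Sum>c\<in>B. \<Sum>j\<in>B. (M a c - M a j)\<^sup>2) = 2 * ?m * s - 2 * P"
    using rows[of 1 "-1"] by simp
  have cols1: "(\<Sum>a\<in>A. \<Sum>c\<in>B. \<Sum>i\<in>A. (M a c - M i c)\<^sup>2) = 2 * ?k * s - 2 * C"
    using cols[of 1 "-1"] by simp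
  \<comment> \<open>Cauchy-Schwarz for each row, in the form of a sum of squared differences;
    \<open>cols0\<close> is the same for columns.\<close>
  have rows0: "0 \<le> 2 * ?m * s - 2 * P" unfolding rows1[symmetric] by (intro sum_nonneg) simp
  have cols0: "0 \<le> 2 * ?k * s - 2 * C" unfolding cols1[symmetric] by (intro sum_nonneg) simp
  have rect: "(\<Sum>a\<in>A. \<Sum>i\<in>A. \<Sum>c\<in>B. \<Sum>j\<in>B. (M a c + M i c + M a j + M i j)\<^sup>2) =
      4 * ?k * ?m * s + 4 * ?k * P + 4 * ?m * C + 4 * t"
    using sum_rectangle_square[where p=1 and M=M and A=A and B=B]
    by (simp add: s_def P_def C_def t_def add.assoc)
  have rect0: "0 \<le> 4 * ?k * ?m * s - 4 * ?k * P - 4 * ?m * C + 4 * t"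
  proof -
    have "0 \<le> (\<Sum>a\<in>A. \<Sum>i\<in>A. \<Sum>c\<in>B. \<Sum>j\<in>B.
        (M a c + (-1) * M i c + (-1) * (M a j + (-1) * M i j))\<^sup>2)"
      by (intro sum_nonneg) simp
    then show ?thesis
      using sum_rectangle_square[where p="-1" and M=M and A=A and B=B]
      by (simp add: s_def P_def C_def t_def)
  qed
  have w: "4 * w \<ge> 16 * ?k * ?m * s - (4 * ?k * ?m * s + 4 * ?k * P + 4 * ?m * C + 4 * t)
      - 4 * (2 * ?m * s - 2 * P) - 4 * (2 * ?k * s - 2 * C)"
    using rectangle_sum_ge[OF fin W1 W2, where M=M] unfolding rect rows1 cols1 w_def s_def .
  \<comment> \<open>The excluded index \<open>j = c\<close> would contribute
    \<open>(M a c - 2 * M a c)^2\<close>, hence the final \<open>- s\<close>.\<close>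
  have r: "(\<Sum>a\<in>A. \<Sum>c\<in>B. \<Sum>j\<in>B-{c}. (M a j - 2 * M a c)\<^sup>2) = 5 * ?m * s - 4 * P - s"
    using rows[of "-2" 1] by (simp add: sum_diff1 fin sum_subtractf s_def cong: sum.cong)
  have c: "(\<Sum>a\<in>A. \<Sum>c\<in>B. \<Sum>i\<in>A-{a}. (M i c - 2 * M a c)\<^sup>2) = 5 * ?k * s - 4 * C - s"
    using cols[of "-2" 1] by (simp add: sum_diff1 fin sum_subtractf s_def cong: sum.cong)
  have tot: "(\<Sum>a\<in>A. \<Sum>c\<in>B. 4 * (M a c)\<^sup>2 + (\<Sum>j\<in>B-{c}. (M a j - 2 * M a c)\<^sup>2)
       + (\<Sum>i\<in>A-{a}. (M i c - 2 * M a c)\<^sup>2)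
       + (\<Sum>i\<in>A-{a}. \<Sum>j\<in>B-{c}. (W a i c j - 2 * M a c)\<^sup>2)) =
       4 * s + (5 * ?m * s - 4 * P - s) + (5 * ?k * s - 4 * C - s) + w"
    by (simp only: sum.distrib r c w_def sum_distrib_left[symmetric] s_def)
  \<comment> \<open>After inserting the bound \<open>w\<close>, the surplus is a quarter of the form
    in \<open>rect0\<close> plus the forms in \<open>rows0\<close> and \<open>cols0\<close>.\<close>
  show ?thesis
    unfolding tot t_def[symmetric] using w rect0 rows0 cols0 by (simp add: algebra_simps)
qed

section \<open>Neighbourhoods in the slice graph\<close>

definition ones :: "nat \<Rightarrow> (nat \<Rightarrow> int) \<Rightarrow> nat set" where
  "ones n x = {i \<in> {1..n}. x i = 1}"

definition zeros :: "nat \<Rightarrow> (nat \<Rightarrow> int) \<Rightarrow> nat set" where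
  "zeros n x = {i \<in> {1..n}. x i = 0}"

definition swap :: "(nat \<Rightarrow> int) \<Rightarrow> nat \<Rightarrow> nat \<Rightarrow> nat \<Rightarrow> int" where
  "swap x i j = x(i := 0, j := 1)"

lemma finite_ones [simp]: "finite (ones n x)" and finite_zeros [simp]: "finite (zeros n x)"
  by (simp_all add: ones_def zeros_def)

lemma slice_verts_values:
  assumes "x \<in> slice_verts n k" "i \<in> {1..n}"
  shows "x i = 0 \<or> x i = 1"
proof -
  have "x \<in> {1..n} \<rightarrow>\<^sub>E {0, 1}" using assms(1) by (simp add: slice_verts_def)
  from PiE_mem[OF this assms(2)] show ?thesis by simp
qed

lemma
  assumes "x \<in> slice_verts n k"
  shows card_ones: "card (ones n x) = k" and card_zeros: "card (zeros n x) = n - k"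
proof -
  note x = slice_verts_values[OF assms]
  have "(\<Sum>i=1..n. x i) = (\<Sum>i=1..n. if x i = 1 then 1 else 0)"
    using x by (intro sum.cong) auto
  also have "\<dots> = int (card (ones n x))"
    by (simp add: sum.If_cases ones_def Int_def)
  finally show k: "card (ones n x) = k"
    using assms by (simp add: slice_verts_def)
  have "zeros n x = {1..n} - ones n x"
  proof (rule set_eqI)
    fix i show "i \<in> zeros n x \<longleftrightarrow> i \<in> {1..n} - ones n x"
      using x[of i] by (auto simp: ones_def zeros_def)
  qed
  moreover have "ones n x \<subseteq> {1..n}" by (auto simp: ones_def)
  ultimately show "card (zeros n x) = n - k"
    using card_Diff_subset[of "ones n x" "{1..n}"] k by simp
qed

lemma
  assumes "x \<in> slice_verts n k" "i \<in> ones n x" "j \<in> zeros n x"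
  shows swap_in_verts: "swap x i j \<in> slice_verts n k"
    and swap_adj: "slice_adj n x (swap x i j)"
proof -
  have ij: "i \<in> {1..n}" "x i = 1" "j \<in> {1..n}" "x j = 0" "i \<noteq> j"
    using assms by (auto simp: ones_def zeros_def)
  have "(\<Sum>l=1..n. swap x i j l) =
      (\<Sum>l=1..n. x l + (if l = j then 1 else 0) - (if l = i then 1 else 0))"
    using ij by (intro sum.cong) (auto simp: swap_def)
  also have "\<dots> = int k"
    using assms(1) ij by (simp add: sum.distrib sum_subtractf slice_verts_def)
  finally show "swap x i j \<in> slice_verts n k"
    using assms(1) ij by (auto simp: slice_verts_def swap_def PiE_def Pi_def extensional_def)
  have "{l \<in> {1..n}. x l - swap x i j l \<noteq> 0} = {i, j}"
    using ij by (auto simp: swap_def)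
  then show "slice_adj n x (swap x i j)"
    using ij by (simp add: slice_adj_def)
qed

text \<open>Both vertices have coordinate sum \<open>k\<close>, so the differences at the two places
  where they disagree cancel: one place loses a one and the other gains it. Outside
  \<open>{1..n}\<close> extensionality gives equality.\<close>

lemma adj_imp_swap:
  assumes x: "x \<in> slice_verts n k" and y: "y \<in> slice_verts n k" and adj: "slice_adj n x y"
  shows "\<exists>i\<in>ones n x. \<exists>j\<in>zeros n x. y = swap x i j"
proof -
  let ?D = "{i \<in> {1..n}. x i - y i \<noteq> 0}"
  obtain p q where D: "?D = {p, q}" and pq: "p \<noteq> q"
    using adj unfolding slice_adj_def card_2_iff by auto
  have mem: "p \<in> {1..n}" "q \<in> {1..n}" "x p \<noteq> y p" "x q \<noteq> y q" using D by auto
  have "(\<Sum>i\<in>?D. x i - y i) = (\<Sum>i=1..n. x i - y i)"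
    by (intro sum.mono_neutral_left) auto
  also have "\<dots> = 0" using x y by (simp add: sum_subtractf slice_verts_def)
  finally have s: "x p - y p + (x q - y q) = 0" unfolding D using pq by simp
  have out: "x l = y l" if "l \<noteq> p" "l \<noteq> q" for l
  proof (cases "l \<in> {1..n}")
    case True
    then show ?thesis using D that by auto
  next
    case False
    then show ?thesis using x y by (auto simp: slice_verts_def PiE_def extensional_def)
  qed
  have vp: "x p = 0 \<or> x p = 1" "y p = 0 \<or> y p = 1" "x q = 0 \<or> x q = 1" "y q = 0 \<or> y q = 1"
    using slice_verts_values x y mem by blast+
  then consider "x p = 1" "y p = 0" "x q = 0" "y q = 1" | "x p = 0" "y p = 1" "x q = 1" "y q = 0"
    using mem s by fastforce
  then show ?thesis
  proof cases
    case 1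
    then have "y = swap x p q" using out by (auto simp: swap_def fun_eq_iff)
    then show ?thesis using 1 mem by (auto simp: ones_def zeros_def)
  next
    case 2
    then have "y = swap x q p" using out by (auto simp: swap_def fun_eq_iff)
    then show ?thesis using 2 mem by (auto simp: ones_def zeros_def)
  qed
qed

text \<open>The pair can be read off the neighbour: \<open>i\<close> is where a one was lost,
  \<open>j\<close> where one was gained. Neighbours thus become matrix cells, with rows indexed by
  the ones of \<open>x\<close> and columns by its zeros.\<close>

lemma bij_betw_swap_nbrs:
  assumes x: "x \<in> slice_verts n k"
  shows "bij_betw (\<lambda>(i, j). swap x i j) (ones n x \<times> zeros n x) (nbrs (slice_verts n k) (slice_adj n) x)"
proof (rule bij_betw_imageI)
  show "inj_on (\<lambda>(i, j). swap x i j) (ones n x \<times> zeros n x)"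
  proof (rule inj_onI, clarify)
    fix i j i' j'
    assume m: "i \<in> ones n x" "j \<in> zeros n x" "i' \<in> ones n x" "j' \<in> zeros n x"
      and eq: "swap x i j = swap x i' j'"
    have "{l. x l = 1 \<and> swap x i j l = 0} = {i}" "{l. x l = 1 \<and> swap x i' j' l = 0} = {i'}"
      "{l. x l = 0 \<and> swap x i j l = 1} = {j}" "{l. x l = 0 \<and> swap x i' j' l = 1} = {j'}"
      using m by (auto simp: swap_def ones_def zeros_def split: if_splits)
    then show "i = i' \<and> j = j'" using eq by auto
  qed
  show "(\<lambda>(i, j). swap x i j) ` (ones n x \<times> zeros n x) = nbrs (slice_verts n k) (slice_adj n) x"
    using swap_in_verts[OF x] swap_adj[OF x] adj_imp_swap[OF x]
    by (fastforce simp: nbrs_def image_iff)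
qed

lemma sum_nbrs:
  fixes g :: "(nat \<Rightarrow> int) \<Rightarrow> real"
  assumes x: "x \<in> slice_verts n k"
  shows "(\<Sum>y\<in>nbrs (slice_verts n k) (slice_adj n) x. g y) =
    (\<Sum>i\<in>ones n x. \<Sum>j\<in>zeros n x. g (swap x i j))"
  using sum.reindex_bij_betw[OF bij_betw_swap_nbrs[OF x], of g]
  by (simp add: sum.cartesian_product case_prod_unfold)

lemma card_nbrs:
  assumes x: "x \<in> slice_verts n k"
  shows "card (nbrs (slice_verts n k) (slice_adj n) x) = k * (n - k)"
  using bij_betw_same_card[OF bij_betw_swap_nbrs[OF x]]
  by (simp add: card_cartesian_product card_ones[OF x] card_zeros[OF x])

lemma
  assumes "a \<in> ones n x" "c \<in> zeros n x"
  shows ones_swap: "ones n (swap x a c) = insert c (ones n x - {a})"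
    and zeros_swap: "zeros n (swap x a c) = insert a (zeros n x - {c})"
  using assms by (auto simp: ones_def zeros_def swap_def)

text \<open>A move from \<open>swap x a c\<close> is classified by whether it empties the new one
  \<open>c\<close> and whether it fills the new zero \<open>a\<close>. Doing both returns to
  \<open>x\<close>, only the first stays in row \<open>a\<close>, only the second stays in column
  \<open>c\<close>, and neither leads to distance two.\<close>

lemma sum_nbrs_swap:
  fixes g :: "(nat \<Rightarrow> int) \<Rightarrow> real"
  assumes x: "x \<in> slice_verts n k" and a: "a \<in> ones n x" and c: "c \<in> zeros n x"
  shows "(\<Sum>z\<in>nbrs (slice_verts n k) (slice_adj n) (swap x a c). g z) =
    g x + (\<Sum>j\<in>zeros n x - {c}. g (swap x a j)) + (\<Sum>i\<in>ones n x - {a}. g (swap x i c))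
    + (\<Sum>i\<in>ones n x - {a}. \<Sum>j\<in>zeros n x - {c}. g (x(a := 0, i := 0, c := 1, j := 1)))"
proof -
  let ?y = "swap x a c"
  have ac: "x a = 1" "x c = 0" "a \<noteq> c" using a c by (auto simp: ones_def zeros_def)
  have nin: "c \<notin> ones n x - {a}" "a \<notin> zeros n x - {c}" using ac by (auto simp: ones_def zeros_def)
  have e1: "swap ?y c a = x" using ac by (auto simp: swap_def)
  have e2: "swap ?y c j = swap x a j" if "j \<in> zeros n x - {c}" for j
    using ac that by (auto simp: swap_def zeros_def fun_eq_iff)
  have e3: "swap ?y i a = swap x i c" if "i \<in> ones n x - {a}" for i
    using ac that by (auto simp: swap_def ones_def fun_eq_iff)
  have e4: "swap ?y i j = x(a := 0, i := 0, c := 1, j := 1)"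
    if "i \<in> ones n x - {a}" "j \<in> zeros n x - {c}" for i j
    using ac that by (auto simp: swap_def ones_def zeros_def fun_eq_iff)
  have "(\<Sum>z\<in>nbrs (slice_verts n k) (slice_adj n) ?y. g z) =
      (\<Sum>i\<in>insert c (ones n x - {a}). \<Sum>j\<in>insert a (zeros n x - {c}). g (swap ?y i j))"
    by (simp only: sum_nbrs[OF swap_in_verts[OF x a c]] ones_swap[OF a c] zeros_swap[OF a c])
  also have "\<dots> = g (swap ?y c a) + (\<Sum>j\<in>zeros n x - {c}. g (swap ?y c j))
      + ((\<Sum>i\<in>ones n x - {a}. g (swap ?y i a))
         + (\<Sum>i\<in>ones n x - {a}. \<Sum>j\<in>zeros n x - {c}. g (swap ?y i j)))"
    by (simp only: sum.insert[OF finite_Diff[OF finite_ones] nin(1)]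
        sum.insert[OF finite_Diff[OF finite_zeros] nin(2)] sum.distrib)
  also have "\<dots> = g x + (\<Sum>j\<in>zeros n x - {c}. g (swap x a j))
      + ((\<Sum>i\<in>ones n x - {a}. g (swap x i c))
         + (\<Sum>i\<in>ones n x - {a}. \<Sum>j\<in>zeros n x - {c}. g (x(a := 0, i := 0, c := 1, j := 1))))"
    by (simp only: e1 e2 e3 e4 cong: sum.cong)
  finally show ?thesis by simp
qed

section \<open>The curvature of the slice: lower bound and sharpness\<close>

lemma Gamma_slice:
  assumes x: "x \<in> slice_verts n k"
  shows "Gamma (slice_verts n k) (slice_adj n) f f x =
    1/2 * (\<Sum>a\<in>ones n x. \<Sum>c\<in>zeros n x. (f (swap x a c) - f x)\<^sup>2)"
  unfolding Gamma_def sum_nbrs[OF x] by (simp add: power2_eq_square algebra_simps)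

text \<open>Every vertex has degree \<open>k * (n - k)\<close>, so \<open>Gamma2_regular\<close>
  applies, and \<open>sum_nbrs_swap\<close> splits its inner sums. The return to \<open>x\<close>
  contributes \<open>(0 - 2 * M a c)^2\<close>, which is the term
  \<open>4 * (M a c)^2\<close>.\<close>

lemma Gamma2_slice:
  fixes f :: "(nat \<Rightarrow> int) \<Rightarrow> real"
  assumes x: "x \<in> slice_verts n k"
  defines "M \<equiv> \<lambda>a c. f (swap x a c) - f x"
    and "W \<equiv> \<lambda>a i c j. f (x(a := 0, i := 0, c := 1, j := 1)) - f x"
  shows "4 * Gamma2 (slice_verts n k) (slice_adj n) f x =
    (\<Sum>a\<in>ones n x. \<Sum>c\<in>zeros n x. 4 * (M a c)\<^sup>2 + (\<Sum>j\<in>zeros n x-{c}. (M a j - 2 * M a c)\<^sup>2)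
       + (\<Sum>i\<in>ones n x-{a}. (M i c - 2 * M a c)\<^sup>2)
       + (\<Sum>i\<in>ones n x-{a}. \<Sum>j\<in>zeros n x-{c}. (W a i c j - 2 * M a c)\<^sup>2))
    - 2 * (real k * real (n - k)) * (\<Sum>a\<in>ones n x. \<Sum>c\<in>zeros n x. (M a c)\<^sup>2)
    + 2 * (\<Sum>a\<in>ones n x. \<Sum>c\<in>zeros n x. M a c)\<^sup>2"
proof -
  let ?V = "slice_verts n k" and ?E = "slice_adj n"
  have fin: "finite (nbrs ?V ?E x)" by (simp add: nbrs_def finite_slice_verts)
  have deg: "card (nbrs ?V ?E y) = k * (n - k)" if "y \<in> nbrs ?V ?E x" for y
    using that by (intro card_nbrs) (simp add: nbrs_def)
  have inner: "(\<Sum>z\<in>nbrs ?V ?E (swap x a c). (f z - f x - 2 * (f (swap x a c) - f x))\<^sup>2) =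
      4 * (M a c)\<^sup>2 + (\<Sum>j\<in>zeros n x-{c}. (M a j - 2 * M a c)\<^sup>2)
       + (\<Sum>i\<in>ones n x-{a}. (M i c - 2 * M a c)\<^sup>2)
       + (\<Sum>i\<in>ones n x-{a}. \<Sum>j\<in>zeros n x-{c}. (W a i c j - 2 * M a c)\<^sup>2)"
    if "a \<in> ones n x" "c \<in> zeros n x" for a c
    unfolding sum_nbrs_swap[OF x that] M_def W_def by (simp add: power2_eq_square algebra_simps)
  have "4 * Gamma2 ?V ?E f x =
      (\<Sum>y\<in>nbrs ?V ?E x. \<Sum>z\<in>nbrs ?V ?E y. (f z - f x - 2 * (f y - f x))\<^sup>2)
      - 2 * real (k * (n - k)) * (\<Sum>y\<in>nbrs ?V ?E x. (f y - f x)\<^sup>2)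
      + 2 * (\<Sum>y\<in>nbrs ?V ?E x. f y - f x)\<^sup>2"
    by (rule Gamma2_regular[OF fin card_nbrs[OF x] deg])
  then show ?thesis
    unfolding sum_nbrs[OF x] by (simp only: inner cong: sum.cong) (simp add: M_def)
qed

lemma curvature_ge_slice:
  assumes "k < n"
  shows "curvature_ge (slice_verts n k) (slice_adj n) (1 + real n / 2)"
  unfolding curvature_ge_def
proof (intro allI ballI)
  fix f :: "(nat \<Rightarrow> int) \<Rightarrow> real" and x assume x: "x \<in> slice_verts n k"
  define M where "M a c = f (swap x a c) - f x" for a c
  define W where "W a i c j = f (x(a := 0, i := 0, c := 1, j := 1)) - f x" for a i c j
  \<comment> \<open>The order of removing two ones, or of filling two zeros, is immaterial:
    \<open>W\<close> depends only on the rectangle.\<close>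
  have W1: "W a i c j = W i a c j" for a i c j
  proof -
    have "x(a := 0, i := 0) = x(i := 0, a := 0)" by auto
    then show ?thesis by (simp add: W_def)
  qed
  have W2: "W a i c j = W a i j c" for a i c j
  proof -
    have "x(a := 0, i := 0, c := 1, j := 1) = x(a := 0, i := 0, j := 1, c := 1)" by auto
    then show ?thesis by (simp add: W_def)
  qed
  have "(real k + real (n - k) + 2) * (\<Sum>a\<in>ones n x. \<Sum>c\<in>zeros n x. (M a c)\<^sup>2)
      \<le> 4 * Gamma2 (slice_verts n k) (slice_adj n) f x"
    using matrix_curvature_ge[OF finite_ones[of n x] finite_zeros[of n x] W1 W2, of M]
    unfolding Gamma2_slice[OF x] by (simp add: card_ones[OF x] card_zeros[OF x] M_def W_def)
  \<comment> \<open>\<open>Gamma\<close> is half the sum of squares, so the factor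
    \<open>n + 2\<close> against \<open>4 * Gamma2\<close> becomes
    \<open>(n + 2) / 2\<close>.\<close>
  then show "(1 + real n / 2) * Gamma (slice_verts n k) (slice_adj n) f f x
      \<le> Gamma2 (slice_verts n k) (slice_adj n) f x"
    unfolding Gamma_slice[OF x] M_def using assms by (simp add: algebra_simps of_nat_diff)
qed

text \<open>For the distance from \<open>x\<close>, all entries of \<open>M\<close> are 1 and all
  values at distance two are 2, exactly half the sum over the four cells, so the minimisation is
  attained. A constant matrix also makes the mixed differences and the row and column differences
  vanish.\<close>

lemma curvature_le_slice:
  assumes k: "1 \<le> k" "k < n" and K: "curvature_ge (slice_verts n k) (slice_adj n) K"
  shows "K \<le> 1 + real n / 2"
proof -
  define x :: "nat \<Rightarrow> int" where
    "x i = (if i \<in> {1..n} then if i \<le> k then 1 else 0 else undefined)" for i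
  have "(\<Sum>i=1..n. x i) = (\<Sum>i=1..k. 1)"
    using k by (intro sum.mono_neutral_cong_right) (auto simp: x_def)
  then have x: "x \<in> slice_verts n k"
    by (auto simp: slice_verts_def x_def PiE_def Pi_def extensional_def)
  \<comment> \<open>Up to an additive constant, \<open>f\<close> is the graph distance from \<open>x\<close>.\<close>
  define f :: "(nat \<Rightarrow> int) \<Rightarrow> real" where "f y = - (\<Sum>i\<in>ones n x. of_int (y i))" for y
  have M: "f (swap x a c) - f x = 1" if "a \<in> ones n x" "c \<in> zeros n x" for a c
  proof -
    have "(\<Sum>i\<in>ones n x. real_of_int (swap x a c i)) =
        (\<Sum>i\<in>ones n x. real_of_int (x i) - (if i = a then 1 else 0))"
      using that by (intro sum.cong) (auto simp: swap_def ones_def zeros_def)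
    then show ?thesis using that by (simp add: f_def sum_subtractf)
  qed
  have W: "f (x(a := 0, i := 0, c := 1, j := 1)) - f x = 2"
    if "a \<in> ones n x" "i \<in> ones n x - {a}" "c \<in> zeros n x" "j \<in> zeros n x - {c}" for a i c j
  proof -
    have "(\<Sum>l\<in>ones n x. real_of_int ((x(a := 0, i := 0, c := 1, j := 1)) l)) =
        (\<Sum>l\<in>ones n x. real_of_int (x l) - (if l = a then 1 else 0) - (if l = i then 1 else 0))"
      using that by (intro sum.cong) (auto simp: ones_def zeros_def)
    then show ?thesis using that by (simp add: f_def sum_subtractf)
  qed
  have pos: "0 < real k * real (n - k)" using k by simp
  have M': "f (swap x i c) - f x = 1" if "i \<in> ones n x - {a}" "c \<in> zeros n x" for a i c
    using that M by blast
  have M'': "f (swap x a j) - f x = 1" if "a \<in> ones n x" "j \<in> zeros n x - {c}" for a c j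
    using that M by blast
  \<comment> \<open>Each cell contributes \<open>4 + (n - k - 1) + (k - 1) = n + 2\<close>: the
    squares along its row and column are \<open>(1 - 2)^2\<close> and those at distance two are
    \<open>(2 - 2)^2\<close>. The last two terms cancel, both sums of ones being
    \<open>k * (n - k)\<close>.\<close>
  have "4 * Gamma2 (slice_verts n k) (slice_adj n) f x =
      (\<Sum>a\<in>ones n x. \<Sum>c\<in>zeros n x. real n + 2)
      - 2 * (real k * real (n - k)) * (\<Sum>a\<in>ones n x. \<Sum>c\<in>zeros n x. 1)
      + 2 * (\<Sum>a\<in>ones n x. \<Sum>c\<in>zeros n x. 1)\<^sup>2"
    unfolding Gamma2_slice[OF x] using k
    by (simp only: M M' M'' W cong: sum.cong) (simp add: card_ones[OF x] card_zeros[OF x] of_nat_diff cong: sum.cong)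
  also have "\<dots> = real k * real (n - k) * (real n + 2)"
    by (simp add: card_ones[OF x] card_zeros[OF x] power2_eq_square)
  finally have "4 * Gamma2 (slice_verts n k) (slice_adj n) f x =
      real k * real (n - k) * (real n + 2)" .
  moreover have "Gamma (slice_verts n k) (slice_adj n) f f x = 1/2 * (real k * real (n - k))"
    unfolding Gamma_slice[OF x] by (simp add: M card_ones[OF x] card_zeros[OF x] cong: sum.cong)
  moreover have "K * Gamma (slice_verts n k) (slice_adj n) f f x
      \<le> Gamma2 (slice_verts n k) (slice_adj n) f x"
    using K x by (simp add: curvature_ge_def)
  ultimately have "(real k * real (n - k)) * (2 * K) \<le> (real k * real (n - k)) * (real n + 2)"
    by (simp only: mult.commute mult.left_commute)
  then have "2 * K \<le> real n + 2" using pos by (simp only: mult_le_cancel_left_pos)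
  then show ?thesis by simp
qed

theorem theorem9:
  fixes n k :: nat
  assumes "n \<ge> 2" and "1 \<le> k" and "k < n"
  shows "is_Ric (slice_verts n k) (slice_adj n) (1 + real n / 2)
       \<and> Ric (slice_verts n k) (slice_adj n) = 1 + real n / 2"
proof -
  have "is_Ric (slice_verts n k) (slice_adj n) (1 + real n / 2)"
    unfolding is_Ric_def using curvature_ge_slice curvature_le_slice assms by blast
  then show ?thesis by (simp add: is_Ric_imp_Ric)
qed

end
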